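(* Let $L=I_1I_2\cdots I_d$ and $M<L$. Let $\mathcal{X}$ be a random tensor with values in $\mathbb{R}^{I_1\times\cdots\times I_d}$ with $E\{\|\mathcal{X}\|^2\}<\infty$, and let $\mathcal{R}_{\mathbf{i},\mathbf{j}}=E\{\mathcal{X}_{\mathbf{i}}\mathcal{X}_{\mathbf{j}}\}$ be its covariance. For a generic orthonormal basis $\{\mathcal{U}_{\mathbf{i},l},\ l=1,\dots,L\}$ of $\mathbb{R}^{I_1\times\cdots\times I_d}$, so that $$\mathcal{X}_{\mathbf{i}}=\sum_{l=1}^{L}\mathcal{U}_{\mathbf{i},l}\,d_l,\qquad d_l=\sum_{\mathbf{i}}\mathcal{X}_{\mathbf{i}}\,\mathcal{U}_{\mathbf{i},l},$$ decompose $\mathcal{X}_{\mathbf{i}}=\hat{\mathcal{X}}_{\mathbf{i}}+\mathcal{N}_{\mathbf{i}}$, where $\hat{\mathcal{X}}_{\mathbf{i}}=\sum_{l=1}^{M}\mathcal{U}_{\mathbf{i},l}\,d_l$ is the subspace representation and $\mathcal{N}_{\mathbf{i}}=\sum_{p=M+1}^{L}\mathcal{U}_{\mathbf{i},p}\,d_p$ is the residual. Then the basis $\{\mathcal{U}_{\mathbf{i},l},\ l=1,\dots,L\}$ that minimizes the error $$\mathcal{E}=E\{\|\mathcal{X}-\hat{\mathcal{X}}\|^2\}$$ is a solution of the eigenvalue equation $$\sum_{\mathbf{j}}\mathcal{R}_{\mathbf{i},\mathbf{j}}\,\mathcal{U}_{\mathbf{j},p}=\lambda_p\,\mathcal{U}_{\mathbf{i},p}\quad\text{for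 all }\mathbf{i},\qquad p=1,\dots,L,$$ with scalars $\lambda_p$ (the eigenvalues).
   Context: An order-$d$ tensor in $\mathbb{R}^{I_1\times\cdots\times I_d}$ is a real array with entries indexed by multi-indices $\mathbf{i}=(i_1,\dots,i_d)$, $1\le i_k\le I_k$; sums over $\mathbf{i}$ or $\mathbf{j}$ run over all such multi-indices. The inner product is $\langle\mathcal{X},\mathcal{Y}\rangle=\sum_{\mathbf{i}}\mathcal{X}_{\mathbf{i}}\mathcal{Y}_{\mathbf{i}}$ and $\|\mathcal{X}\|=\sqrt{\langle\mathcal{X},\mathcal{X}\rangle}$. $\mathcal{U}_{\mathbf{i},l}$ denotes the $\mathbf{i}$ entry of the $l$-th basis tensor; orthonormal means $\sum_{\mathbf{i}}\mathcal{U}_{\mathbf{i},l}\mathcal{U}_{\mathbf{i},l'}=\delta_{l,l'}$, where $\delta_{l,l'}=1$ if $l=l'$ and $0$ otherwise. $E\{\cdot\}$ denotes the mean value (the covariance here is the uncentered second moment).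
   Formalization: A minimizing basis need not itself solve the eigenvalue equation (the first M, or the last L−M, tensors may be rotated among themselves); proved instead: a minimizer exists, and each minimizer has the same subspace representation as some minimizing basis that solves the equation for all p. *)

theory Defs
  imports "HOL-Probability.Probability"
begin

text \<open>A tensor of order \<open>d\<close> with dimensions \<open>I 1, \<dots>, I d\<close> is a function on multi-indices; only its
  values on \<open>multi_indices d I\<close> are relevant. A family of tensors \<open>U\<close> is written \<open>U i l\<close>, where \<open>i\<close> is
  the multi-index and \<open>l\<close> numbers the tensors.\<close>

type_synonym tensor = "(nat \<Rightarrow> nat) \<Rightarrow> real"

definition multi_indices :: "nat \<Rightarrow> (nat \<Rightarrow> nat) \<Rightarrow> (nat \<Rightarrow> nat) set" where
  "multi_indices d I = (\<Pi>\<^sub>E k\<in>{1..d}. {1..I k})"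

definition tensor_dim :: "nat \<Rightarrow> (nat \<Rightarrow> nat) \<Rightarrow> nat" where
  "tensor_dim d I = (\<Prod>k=1..d. I k)"

definition tensor_inner :: "nat \<Rightarrow> (nat \<Rightarrow> nat) \<Rightarrow> tensor \<Rightarrow> tensor \<Rightarrow> real" where
  "tensor_inner d I X Y = (\<Sum>i\<in>multi_indices d I. X i * Y i)"

definition tensor_norm :: "nat \<Rightarrow> (nat \<Rightarrow> nat) \<Rightarrow> tensor \<Rightarrow> real" where
  "tensor_norm d I X = sqrt (tensor_inner d I X X)"

definition orthonormal_basis ::
    "nat \<Rightarrow> (nat \<Rightarrow> nat) \<Rightarrow> ((nat \<Rightarrow> nat) \<Rightarrow> nat \<Rightarrow> real) \<Rightarrow> bool" where
  "orthonormal_basis d I U \<longleftrightarrow>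
     (\<forall>l\<in>{1..tensor_dim d I}. \<forall>l'\<in>{1..tensor_dim d I}.
        (\<Sum>i\<in>multi_indices d I. U i l * U i l') = (if l = l' then 1 else 0)) \<and>
     (\<forall>Y :: tensor. \<exists>c. \<forall>i\<in>multi_indices d I. Y i = (\<Sum>l=1..tensor_dim d I. U i l * c l))"

definition basis_coeff ::
    "nat \<Rightarrow> (nat \<Rightarrow> nat) \<Rightarrow> ((nat \<Rightarrow> nat) \<Rightarrow> nat \<Rightarrow> real) \<Rightarrow> tensor \<Rightarrow> nat \<Rightarrow> real" where
  "basis_coeff d I U X l = (\<Sum>i\<in>multi_indices d I. X i * U i l)"

definition subspace_repr ::
    "nat \<Rightarrow> (nat \<Rightarrow> nat) \<Rightarrow> nat \<Rightarrow> ((nat \<Rightarrow> nat) \<Rightarrow> nat \<Rightarrow> real) \<Rightarrow> tensor \<Rightarrow> tensor" where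
  "subspace_repr d I M U X i = (\<Sum>l=1..M. U i l * basis_coeff d I U X l)"

definition residual ::
    "nat \<Rightarrow> (nat \<Rightarrow> nat) \<Rightarrow> nat \<Rightarrow> ((nat \<Rightarrow> nat) \<Rightarrow> nat \<Rightarrow> real) \<Rightarrow> tensor \<Rightarrow> tensor" where
  "residual d I M U X i = (\<Sum>p=M+1..tensor_dim d I. U i p * basis_coeff d I U X p)"

lemma basis_expansion:
  assumes U: "orthonormal_basis d I U" and i: "i \<in> multi_indices d I"
  shows "X i = (\<Sum>l=1..tensor_dim d I. U i l * basis_coeff d I U X l)"
proof -
  obtain c where c: "\<And>i. i \<in> multi_indices d I \<Longrightarrow> X i = (\<Sum>l=1..tensor_dim d I. U i l * c l)"
    using U unfolding orthonormal_basis_def by meson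
  have "basis_coeff d I U X l = c l" if l: "l \<in> {1..tensor_dim d I}" for l
  proof -
    have "basis_coeff d I U X l
        = (\<Sum>i\<in>multi_indices d I. \<Sum>m=1..tensor_dim d I. c m * (U i m * U i l))"
      unfolding basis_coeff_def
      by (intro sum.cong refl) (simp add: c sum_distrib_right mult.assoc mult.left_commute)
    also have "\<dots> = (\<Sum>m=1..tensor_dim d I. c m * (\<Sum>i\<in>multi_indices d I. U i m * U i l))"
      by (subst sum.swap) (simp add: sum_distrib_left)
    also have "\<dots> = (\<Sum>m=1..tensor_dim d I. if m = l then c m else 0)"
      using U l by (intro sum.cong) (auto simp: orthonormal_basis_def)
    also have "\<dots> = c l" using l by simp
    finally show ?thesis .
  qed
  then show ?thesis using c[OF i] by simp
qed

lemma subspace_repr_plus_residual: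
  assumes U: "orthonormal_basis d I U" and i: "i \<in> multi_indices d I" and M: "M < tensor_dim d I"
  shows "X i = subspace_repr d I M U X i + residual d I M U X i"
proof -
  have "{1..tensor_dim d I} = {1..M} \<union> {M+1..tensor_dim d I}" using M by auto
  then have "(\<Sum>l=1..tensor_dim d I. U i l * basis_coeff d I U X l)
      = subspace_repr d I M U X i + residual d I M U X i"
    by (simp add: subspace_repr_def residual_def sum.union_disjoint)
  then show ?thesis
    using basis_expansion[OF U i, of X] by simp
qed

definition covariance :: "'a measure \<Rightarrow> ('a \<Rightarrow> tensor) \<Rightarrow> (nat \<Rightarrow> nat) \<Rightarrow> (nat \<Rightarrow> nat) \<Rightarrow> real" where
  "covariance P X i j = (\<integral>\<omega>. X \<omega> i * X \<omega> j \<partial>P)"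

definition approx_error ::
    "'a measure \<Rightarrow> ('a \<Rightarrow> tensor) \<Rightarrow> nat \<Rightarrow> (nat \<Rightarrow> nat) \<Rightarrow> nat \<Rightarrow> ((nat \<Rightarrow> nat) \<Rightarrow> nat \<Rightarrow> real) \<Rightarrow> real"
    where
  "approx_error P X d I M U =
     (\<integral>\<omega>. (tensor_norm d I (\<lambda>i. X \<omega> i - subspace_repr d I M U (X \<omega>) i))\<^sup>2 \<partial>P)"

definition solves_eigenvalue_eq ::
    "nat \<Rightarrow> (nat \<Rightarrow> nat) \<Rightarrow> ((nat \<Rightarrow> nat) \<Rightarrow> (nat \<Rightarrow> nat) \<Rightarrow> real) \<Rightarrow> ((nat \<Rightarrow> nat) \<Rightarrow> nat \<Rightarrow> real) \<Rightarrow> bool"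
    where
  "solves_eigenvalue_eq d I R U \<longleftrightarrow>
     (\<exists>ev :: nat \<Rightarrow> real. \<forall>p\<in>{1..tensor_dim d I}. \<forall>i\<in>multi_indices d I.
        (\<Sum>j\<in>multi_indices d I. R i j * U j p) = ev p * U i p)"

end

theory Submission
  imports Defs
begin

text \<open>Up to the constant \<open>E \<parallel>X\<parallel>\<^sup>2\<close>, the error is minus the sum of the Rayleigh quotients of the covariance
  \<open>R\<close> at the first \<open>M\<close> basis tensors, so a minimiser exists by compactness of the orthogonal group.
  Given a minimiser \<open>U\<close>, choose \<open>V\<close> among the bases with the same rank-\<open>M\<close> projection so as to
  maximise \<open>\<Sum>l. l * \<langle>V\<^sub>l, R V\<^sub>l\<rangle>\<close>. Rotating \<open>V\<close> in the plane of \<open>V\<^sub>p\<close> and \<open>V\<^sub>q\<close> changes a weighted sum of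
  Rayleigh quotients to first order by a multiple of \<open>(w\<^sub>p - w\<^sub>q) * \<langle>V\<^sub>p, R V\<^sub>q\<rangle>\<close>. If \<open>p\<close> and \<open>q\<close> lie on the
  same side of \<open>M\<close>, the rotation keeps the projection and the choice of \<open>V\<close> makes this vanish; otherwise
  minimality of the error does. Hence \<open>V\<close> diagonalises \<open>R\<close>.\<close>

section \<open>Orthogonal arrays, weighted Rayleigh sums and plane rotations\<close>

text \<open>The column relations express orthonormality of the family, the row relations its
  completeness. Carrying both makes expansions in the family available without a dimension
  argument.\<close>

definition orthogonal_on :: "'i set \<Rightarrow> 'l set \<Rightarrow> ('i \<Rightarrow> 'l \<Rightarrow> real) \<Rightarrow> bool" where
  "orthogonal_on A B V \<longleftrightarrow>
     (\<forall>l\<in>B. \<forall>m\<in>B. (\<Sum>i\<in>A. V i l * V i m) = (if l = m then 1 else 0)) \<and>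
     (\<forall>i\<in>A. \<forall>j\<in>A. (\<Sum>l\<in>B. V i l * V j l) = (if i = j then 1 else 0))"

definition bilin :: "'i set \<Rightarrow> ('i \<Rightarrow> 'i \<Rightarrow> real) \<Rightarrow> ('i \<Rightarrow> real) \<Rightarrow> ('i \<Rightarrow> real) \<Rightarrow> real" where
  "bilin A R x y = (\<Sum>i\<in>A. \<Sum>j\<in>A. R i j * x i * y j)"

text \<open>The weights serve two optimisations: \<open>of_bool (l \<le> M)\<close> gives the energy
  captured by the first \<open>M\<close> tensors, and \<open>real\<close> selects among bases with
  the same projection.\<close>

definition rayleigh_sum ::
    "'i set \<Rightarrow> 'l set \<Rightarrow> ('i \<Rightarrow> 'i \<Rightarrow> real) \<Rightarrow> ('l \<Rightarrow> real) \<Rightarrow> ('i \<Rightarrow> 'l \<Rightarrow> real) \<Rightarrow> real" where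
  "rayleigh_sum A B R w V = (\<Sum>l\<in>B. w l * bilin A R (\<lambda>i. V i l) (\<lambda>i. V i l))"

text \<open>A Givens rotation of two columns. With \<open>c\<close> and \<open>s\<close> as
  parameters instead of an angle, all identities stay polynomial modulo
  \<open>c^2 + s^2 = 1\<close>.\<close>

definition rotate_cols ::
    "'l \<Rightarrow> 'l \<Rightarrow> real \<Rightarrow> real \<Rightarrow> ('i \<Rightarrow> 'l \<Rightarrow> real) \<Rightarrow> 'i \<Rightarrow> 'l \<Rightarrow> real" where
  "rotate_cols p q c s V i l =
     (if l = p then c * V i p + s * V i q else if l = q then c * V i q - s * V i p else V i l)"

lemma bilin_lincomb_left:
  "bilin A R (\<lambda>i. a * x i + b * y i) z = a * bilin A R x z + b * bilin A R y z"
  by (simp add: bilin_def sum_distrib_left algebra_simps flip: sum.distrib)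

lemma bilin_lincomb_right:
  "bilin A R z (\<lambda>i. a * x i + b * y i) = a * bilin A R z x + b * bilin A R z y"
  by (simp add: bilin_def sum_distrib_left algebra_simps flip: sum.distrib)

lemma bilin_commute:
  assumes "\<And>i j. R i j = R j i"
  shows "bilin A R x y = bilin A R y x"
proof -
  have "bilin A R x y = (\<Sum>j\<in>A. \<Sum>i\<in>A. R i j * x i * y j)"
    unfolding bilin_def by (rule sum.swap)
  also have "\<dots> = bilin A R y x"
    unfolding bilin_def by (intro sum.cong refl) (simp add: assms mult_ac)
  finally show ?thesis .
qed

text \<open>In the two columns every row undergoes the same planar rotation, which preserves inner
  products. \<open>C = B\<close> yields completeness of the rotated family,
  \<open>C = {1..M}\<close> an unchanged rank-\<open>M\<close> projection.\<close>

lemma sum_rotate_cols: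
  assumes "finite C" "p \<noteq> q" "p \<in> C \<longleftrightarrow> q \<in> C" and cs: "c\<^sup>2 + s\<^sup>2 = 1"
  shows "(\<Sum>l\<in>C. rotate_cols p q c s V i l * rotate_cols p q c s V j l) = (\<Sum>l\<in>C. V i l * V j l)"
proof (cases "p \<in> C")
  case False
  with assms show ?thesis by (intro sum.cong) (auto simp: rotate_cols_def)
next
  case True
  with assms have q: "q \<in> C - {p}" by simp
  have split: "sum f C = f p + f q + sum f (C - {p} - {q})" for f :: "_ \<Rightarrow> real"
    using assms(1) True q by (simp add: sum.remove[of C p] sum.remove[of "C - {p}" q])
  have rest: "(\<Sum>l\<in>C - {p} - {q}. rotate_cols p q c s V i l * rotate_cols p q c s V j l)
      = (\<Sum>l\<in>C - {p} - {q}. V i l * V j l)"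
    by (intro sum.cong) (auto simp: rotate_cols_def)
  have "(c * x + s * y) * (c * x' + s * y') + (c * y - s * x) * (c * y' - s * x')
      = (c\<^sup>2 + s\<^sup>2) * (x * x' + y * y')" for x x' y y' :: real
    by (simp add: algebra_simps power2_eq_square)
  then have "(c * V i p + s * V i q) * (c * V j p + s * V j q)
      + (c * V i q - s * V i p) * (c * V j q - s * V j p) = V i p * V j p + V i q * V j q"
    by (simp add: cs)
  with \<open>p \<noteq> q\<close> show ?thesis
    unfolding split rest by (simp add: rotate_cols_def)
qed

lemma orthogonal_on_rotate_cols:
  assumes V: "orthogonal_on A B V" and B: "finite B" and pq: "p \<in> B" "q \<in> B" "p \<noteq> q"
    and cs: "c\<^sup>2 + s\<^sup>2 = 1"
  shows "orthogonal_on A B (rotate_cols p q c s V)"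
proof -
  define ip where "ip x y = (\<Sum>i\<in>A. x i * y i)" for x y :: "_ \<Rightarrow> real"
  have ip_lincomb: "ip (\<lambda>i. a * x i + b * y i) (\<lambda>i. a' * x' i + b' * y' i)
      = a * a' * ip x x' + a * b' * ip x y' + b * a' * ip y x' + b * b' * ip y y'"
    for a b a' b' x y x' y'
    by (simp add: ip_def sum_distrib_left algebra_simps flip: sum.distrib)
  \<comment> \<open>Writing every column as a combination of some old column and column
    \<open>q\<close> lets one bilinear expansion cover all cases of \<open>l\<close> and
    \<open>m\<close>.\<close>
  have col: "(\<lambda>i. rotate_cols p q c s V i l) =
      (\<lambda>i. (if l = p then c else if l = q then - s else 1) * V i (if l = q then p else l) +
           (if l = p then s else if l = q then c else 0) * V i q)" for l
    using pq by (auto simp: rotate_cols_def)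
  have "(\<Sum>i\<in>A. rotate_cols p q c s V i l * rotate_cols p q c s V i m) = (if l = m then 1 else 0)"
    if lm: "l \<in> B" "m \<in> B" for l m
  proof -
    have on: "\<And>l m. l \<in> B \<Longrightarrow> m \<in> B \<Longrightarrow> ip (\<lambda>i. V i l) (\<lambda>i. V i m) = (if l = m then 1 else 0)"
      using V by (simp add: orthogonal_on_def ip_def)
    have "(\<Sum>i\<in>A. rotate_cols p q c s V i l * rotate_cols p q c s V i m)
        = ip (\<lambda>i. rotate_cols p q c s V i l) (\<lambda>i. rotate_cols p q c s V i m)"
      by (simp only: ip_def)
    also have "\<dots> = (if l = m then 1 else 0)"
      unfolding col ip_lincomb using lm pq cs by (auto simp: on power2_eq_square)
    finally show ?thesis .
  qed
  moreover have "(\<Sum>l\<in>B. rotate_cols p q c s V i l * rotate_cols p q c s V j l) = (if i = j then 1 else 0)"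
    if "i \<in> A" "j \<in> A" for i j
    using V that pq by (simp add: sum_rotate_cols[OF B _ _ cs] orthogonal_on_def)
  ultimately show ?thesis unfolding orthogonal_on_def by blast
qed

text \<open>A rotation preserves the trace of the form on the plane of the two columns, so one
  Rayleigh quotient gains what the other loses. This is why the weights enter only through
  \<open>w p - w q\<close>.\<close>

lemma rayleigh_sum_rotate_cols:
  fixes A :: "'i set" and V :: "'i \<Rightarrow> 'l \<Rightarrow> real"
  assumes R: "\<And>i j. R i j = R j i" and B: "finite B" and pq: "p \<in> B" "q \<in> B" "p \<noteq> q"
    and cs: "c\<^sup>2 + s\<^sup>2 = 1"
  defines "b \<equiv> \<lambda>l m. bilin A R (\<lambda>i. V i l) (\<lambda>i. V i m)"
  shows "rayleigh_sum A B R w (rotate_cols p q c s V) =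
    rayleigh_sum A B R w V + (w p - w q) * (2 * c * s * b p q + s\<^sup>2 * (b q q - b p p))"
proof -
  let ?W = "rotate_cols p q c s V"
  let ?b = "\<lambda>l. bilin A R (\<lambda>i. ?W i l) (\<lambda>i. ?W i l)"
  have qB: "q \<in> B - {p}" using pq by simp
  have split: "sum f B = f p + f q + sum f (B - {p} - {q})" for f :: "_ \<Rightarrow> real"
    using B pq qB by (simp add: sum.remove[of B p] sum.remove[of "B - {p}" q])
  have sym: "b q p = b p q" unfolding b_def by (rule bilin_commute[OF R])
  have c2: "c\<^sup>2 = 1 - s\<^sup>2" using cs by simp
  have Wp: "(\<lambda>i. ?W i p) = (\<lambda>i. c * V i p + s * V i q)"
    by (simp add: rotate_cols_def)
  have Wq: "(\<lambda>i. ?W i q) = (\<lambda>i. c * V i q + (- s) * V i p)"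
    using pq by (auto simp: rotate_cols_def)
  have "?b p = c\<^sup>2 * b p p + 2 * c * s * b p q + s\<^sup>2 * b q q"
    unfolding Wp bilin_lincomb_left bilin_lincomb_right
    using sym by (simp add: b_def power2_eq_square algebra_simps)
  then have bp: "?b p = b p p + (2 * c * s * b p q + s\<^sup>2 * (b q q - b p p))"
    unfolding c2 by (simp add: algebra_simps)
  have "?b q = c\<^sup>2 * b q q - 2 * c * s * b p q + s\<^sup>2 * b p p"
    unfolding Wq bilin_lincomb_left bilin_lincomb_right
    using sym by (simp add: b_def power2_eq_square algebra_simps)
  then have bq: "?b q = b q q - (2 * c * s * b p q + s\<^sup>2 * (b q q - b p p))"
    unfolding c2 by (simp add: algebra_simps)
  have rest: "(\<Sum>l\<in>B - {p} - {q}. w l * ?b l) = (\<Sum>l\<in>B - {p} - {q}. w l * b l l)"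
    unfolding b_def by (intro sum.cong) (auto simp: rotate_cols_def)
  have "rayleigh_sum A B R w V = (\<Sum>l\<in>B. w l * b l l)"
    by (simp add: rayleigh_sum_def b_def)
  then show ?thesis
    unfolding rayleigh_sum_def[of _ _ _ _ ?W] split rest bp bq by (simp add: algebra_simps)
qed

section \<open>First-order optimality and eigenvectors\<close>

text \<open>The quadratic vanishes at \<open>t = 0\<close> and is thus maximal there, so its
  derivative \<open>2 * k\<close> must be zero.\<close>

lemma linear_coeff_zero:
  fixes k m :: real
  assumes "\<And>t. 2 * t * k + t\<^sup>2 * m \<le> 0"
  shows "k = 0"
proof -
  \<comment> \<open>This \<open>t\<close> is so small that the quadratic term cannot outweigh the
    linear one: the whole expression is \<open>t^2\<close> times a positive factor, which forces
    \<open>t = 0\<close>.\<close>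
  define t where "t = k / (\<bar>m\<bar> + 1)"
  have k: "k = t * (\<bar>m\<bar> + 1)" by (simp add: t_def)
  have "2 * t * k + t\<^sup>2 * m = t\<^sup>2 * (2 * (\<bar>m\<bar> + 1) + m)"
    unfolding k by (simp add: power2_eq_square algebra_simps)
  then have "t\<^sup>2 * (2 * (\<bar>m\<bar> + 1) + m) \<le> 0" using assms by metis
  moreover have "2 * (\<bar>m\<bar> + 1) + m > 0" by (simp add: abs_if)
  ultimately have "t\<^sup>2 \<le> 0" by (simp add: mult_le_0_iff)
  then show ?thesis by (simp add: k)
qed

text \<open>With the tangent \<open>t = s / c\<close> as parameter, the gain divided by
  \<open>c^2\<close> is a quadratic in \<open>t\<close> whose linear coefficient is a nonzero
  multiple of the off-diagonal entry.\<close>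

lemma bilin_zero_if_rotation_maximal:
  assumes R: "\<And>i j. R i j = R j i" and B: "finite B" and pq: "p \<in> B" "q \<in> B" "p \<noteq> q"
    and w: "w p \<noteq> w q"
    and max: "\<And>c s. c\<^sup>2 + s\<^sup>2 = 1 \<Longrightarrow>
      rayleigh_sum A B R w (rotate_cols p q c s V) \<le> rayleigh_sum A B R w V"
  shows "bilin A R (\<lambda>i. V i p) (\<lambda>i. V i q) = 0"
proof -
  define b where "b = (\<lambda>l m. bilin A R (\<lambda>i. V i l) (\<lambda>i. V i m))"
  have "2 * t * ((w p - w q) * b p q) + t\<^sup>2 * ((w p - w q) * (b q q - b p p)) \<le> 0" for t
  proof -
    \<comment> \<open>The cosine of the angle with tangent \<open>t\<close>; the sine is then
      \<open>c * t\<close>.\<close>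
    define c where "c = 1 / sqrt (1 + t\<^sup>2)"
    have pos: "1 + t\<^sup>2 > 0" by (simp add: add_pos_nonneg)
    then have c2: "c\<^sup>2 * (1 + t\<^sup>2) = 1" by (simp add: c_def power_divide)
    then have cs: "c\<^sup>2 + (c * t)\<^sup>2 = 1" by (simp add: power_mult_distrib algebra_simps)
    have "(w p - w q) * (2 * c * (c * t) * b p q + (c * t)\<^sup>2 * (b q q - b p p)) \<le> 0"
      using max[OF cs] by (simp add: rayleigh_sum_rotate_cols[OF R B pq cs] b_def)
    then have "c\<^sup>2 * (2 * t * ((w p - w q) * b p q) + t\<^sup>2 * ((w p - w q) * (b q q - b p p))) \<le> 0"
      by (simp add: power2_eq_square algebra_simps)
    moreover have "c\<^sup>2 > 0" using pos by (simp add: c_def)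
    ultimately show ?thesis by (simp add: mult_le_0_iff)
  qed
  then have "(w p - w q) * b p q = 0" by (rule linear_coeff_zero)
  with w show ?thesis by (simp add: b_def)
qed

text \<open>By completeness, the image of column \<open>p\<close> under \<open>R\<close> expands in
  the family; only the term along column \<open>p\<close> survives, and its coefficient is the
  eigenvalue.\<close>

lemma eigenvector_if_diagonal:
  assumes V: "orthogonal_on A B V" and fin: "finite A" "finite B" and p: "p \<in> B" and i: "i \<in> A"
    and diag: "\<And>q. q \<in> B \<Longrightarrow> q \<noteq> p \<Longrightarrow> bilin A R (\<lambda>i. V i q) (\<lambda>i. V i p) = 0"
  shows "(\<Sum>j\<in>A. R i j * V j p) = bilin A R (\<lambda>i. V i p) (\<lambda>i. V i p) * V i p"
proof -
  let ?r = "\<lambda>k. \<Sum>j\<in>A. R k j * V j p"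
  have r: "bilin A R (\<lambda>i. V i q) (\<lambda>i. V i p) = (\<Sum>k\<in>A. V k q * ?r k)" for q
    unfolding bilin_def by (simp add: sum_distrib_left mult_ac)
  have "?r i = (\<Sum>k\<in>A. if i = k then ?r k else 0)" using fin i by simp
  also have "\<dots> = (\<Sum>k\<in>A. (\<Sum>q\<in>B. V i q * V k q) * ?r k)"
    using V i by (intro sum.cong) (auto simp: orthogonal_on_def)
  also have "\<dots> = (\<Sum>k\<in>A. \<Sum>q\<in>B. V i q * (V k q * ?r k))"
    by (simp add: sum_distrib_right mult.assoc)
  also have "\<dots> = (\<Sum>q\<in>B. \<Sum>k\<in>A. V i q * (V k q * ?r k))"
    by (rule sum.swap)
  also have "\<dots> = (\<Sum>q\<in>B. V i q * bilin A R (\<lambda>i. V i q) (\<lambda>i. V i p))"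
    by (simp add: r sum_distrib_left)
  also have "\<dots> = (\<Sum>q\<in>B. if q = p then V i q * bilin A R (\<lambda>i. V i q) (\<lambda>i. V i p) else 0)"
    by (intro sum.cong) (auto simp: diag)
  also have "\<dots> = bilin A R (\<lambda>i. V i p) (\<lambda>i. V i p) * V i p" using fin p by simp
  finally show ?thesis .
qed

section \<open>Existence of constrained maximisers by compactness\<close>

text \<open>Unit columns bound the entries by 1, and the constraints are closed polynomial
  equations. The condition on \<open>C\<close> and \<open>T\<close> serves to prescribe a
  projection.\<close>

lemma rayleigh_sum_attains_max:
  fixes A :: "'i set" and B C :: "'l set" and R :: "'i \<Rightarrow> 'i \<Rightarrow> real" and T :: "'i \<Rightarrow> 'i \<Rightarrow> real"
  assumes fin: "finite A" "finite B" and C: "C \<subseteq> B"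
  defines "S \<equiv> {V. orthogonal_on A B V \<and> (\<forall>i\<in>A. \<forall>j\<in>A. (\<Sum>l\<in>C. V i l * V j l) = T i j)}"
  assumes ne: "U \<in> S"
  shows "\<exists>V\<in>S. \<forall>W\<in>S. rayleigh_sum A B R w W \<le> rayleigh_sum A B R w V"
proof -
  \<comment> \<open>Values outside \<open>A \<times> B\<close> are unconstrained, so
    \<open>S\<close> itself need not be compact. Setting them to zero affects neither feasibility
    nor the objective.\<close>
  define trunc where "trunc V x = (if x \<in> A \<times> B then V (fst x) (snd x) else 0)"
    for V :: "'i \<Rightarrow> 'l \<Rightarrow> real" and x
  define box where "box = (PiE UNIV (\<lambda>x. if x \<in> A \<times> B then {-1..1} else {0}) :: ('i \<times> 'l \<Rightarrow> real) set)"
  define K where "K = box \<inter> {g. curry g \<in> S}"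
  have coord [continuous_intros]: "continuous_on X (\<lambda>g. g x)" for X and x :: "'i \<times> 'l"
    using continuous_on_product_coordinates continuous_on_subset by (metis subset_UNIV)
  \<comment> \<open>This is Tychonoff's theorem, so the index types may be infinite.\<close>
  have "compactin (product_topology (\<lambda>_. euclidean) UNIV) box"
    unfolding box_def compactin_PiE by auto
  then have "compact box"
    by (simp add: euclidean_product_topology compactin_euclidean_iff)
  moreover have "closed {g :: 'i \<times> 'l \<Rightarrow> real. curry g \<in> S}"
    unfolding S_def orthogonal_on_def curry_def mem_Collect_eq Ball_def
    by (intro closed_Collect_conj closed_Collect_all closed_Collect_imp closed_Collect_eq
        open_Collect_const continuous_intros)
  ultimately have "compact K" unfolding K_def by (rule compact_Int_closed)
  have S_cong: "curry (trunc V) \<in> S \<longleftrightarrow> V \<in> S" for V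
  proof -
    have "(\<Sum>i\<in>A. curry (trunc V) i l * curry (trunc V) i m) = (\<Sum>i\<in>A. V i l * V i m)"
      if "l \<in> B" "m \<in> B" for l m
      using that by (intro sum.cong) (auto simp: trunc_def)
    moreover have "(\<Sum>l\<in>D. curry (trunc V) i l * curry (trunc V) j l) = (\<Sum>l\<in>D. V i l * V j l)"
      if "i \<in> A" "j \<in> A" "D \<subseteq> B" for i j D
      using that by (intro sum.cong) (auto simp: trunc_def)
    ultimately show ?thesis using C by (simp add: S_def orthogonal_on_def)
  qed
  have obj_cong: "rayleigh_sum A B R w (curry (trunc V)) = rayleigh_sum A B R w V" for V
    unfolding rayleigh_sum_def bilin_def
    by (intro sum.cong arg_cong2[of _ _ _ _ "(*)"] refl) (simp_all add: trunc_def)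
  have trunc_K: "trunc V \<in> K" if V: "V \<in> S" for V
  proof -
    have "trunc V x \<in> (if x \<in> A \<times> B then {-1..1} else {0})" for x
    proof (cases "x \<in> A \<times> B")
      case True
      then obtain i l where x: "x = (i, l)" "i \<in> A" "l \<in> B" by auto
      have "(V i l)\<^sup>2 \<le> (\<Sum>i\<in>A. (V i l)\<^sup>2)"
        using fin x by (intro member_le_sum) auto
      also have "\<dots> = 1"
        using V x by (simp add: S_def orthogonal_on_def power2_eq_square)
      finally have "\<bar>V i l\<bar> \<le> 1" by (simp add: abs_square_le_1)
      then show ?thesis using x by (simp add: trunc_def abs_le_iff)
    qed (simp add: trunc_def)
    then show ?thesis using V by (auto simp: K_def box_def S_cong)
  qed
  have "continuous_on K (\<lambda>g. rayleigh_sum A B R w (curry g))"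
    unfolding rayleigh_sum_def bilin_def curry_def by (intro continuous_intros)
  moreover have "K \<noteq> {}" using trunc_K[OF ne] by auto
  ultimately obtain g where g: "g \<in> K"
    and max: "\<And>h. h \<in> K \<Longrightarrow> rayleigh_sum A B R w (curry h) \<le> rayleigh_sum A B R w (curry g)"
    using continuous_attains_sup[OF \<open>compact K\<close>] by blast
  have "rayleigh_sum A B R w W \<le> rayleigh_sum A B R w (curry g)" if "W \<in> S" for W
    using max[OF trunc_K[OF that]] by (simp add: obj_cong)
  then show ?thesis using g by (auto simp: K_def)
qed

section \<open>Orthonormal tensor bases as orthogonal arrays\<close>

lemma finite_multi_indices: "finite (multi_indices d I)"
  by (simp add: multi_indices_def finite_PiE)

lemma card_multi_indices: "card (multi_indices d I) = tensor_dim d I"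
  by (simp add: multi_indices_def tensor_dim_def card_PiE)

text \<open>Expanding unit tensors turns spanning into the row relations; conversely, the row
  relations show that inner products with the basis serve as expansion coefficients.\<close>

lemma orthonormal_basis_iff:
  "orthonormal_basis d I U \<longleftrightarrow> orthogonal_on (multi_indices d I) {1..tensor_dim d I} U"
  (is "?L \<longleftrightarrow> ?R")
proof
  let ?A = "multi_indices d I" and ?B = "{1..tensor_dim d I}"
  assume L: ?L
  have "(\<Sum>l\<in>?B. U i l * U j l) = (if i = j then 1 else 0)" if ij: "i \<in> ?A" "j \<in> ?A" for i j
  proof -
    \<comment> \<open>The coefficients of the unit tensor at \<open>j\<close> form row
      \<open>j\<close> of \<open>U\<close>, so its expansion at \<open>i\<close> is the wanted
      product of rows.\<close>
    define e :: tensor where "e = (\<lambda>k. if k = j then 1 else 0)"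
    have "basis_coeff d I U e l = U j l" for l
    proof -
      have "basis_coeff d I U e l = (\<Sum>k\<in>?A. if k = j then U k l else 0)"
        unfolding basis_coeff_def e_def by (intro sum.cong) auto
      then show ?thesis using ij finite_multi_indices by simp
    qed
    then show ?thesis using basis_expansion[OF L ij(1), of e] by (simp add: e_def)
  qed
  with L show ?R by (simp add: orthonormal_basis_def orthogonal_on_def)
next
  let ?A = "multi_indices d I" and ?B = "{1..tensor_dim d I}"
  assume R: ?R
  have "Y i = (\<Sum>l\<in>?B. U i l * (\<Sum>j\<in>?A. U j l * Y j))" if i: "i \<in> ?A" for Y :: tensor and i
  proof -
    have "(\<Sum>l\<in>?B. U i l * (\<Sum>j\<in>?A. U j l * Y j)) = (\<Sum>l\<in>?B. \<Sum>j\<in>?A. U i l * U j l * Y j)"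
      by (simp add: sum_distrib_left mult.assoc)
    also have "\<dots> = (\<Sum>j\<in>?A. \<Sum>l\<in>?B. U i l * U j l * Y j)"
      by (rule sum.swap)
    also have "\<dots> = (\<Sum>j\<in>?A. (\<Sum>l\<in>?B. U i l * U j l) * Y j)"
      by (simp only: sum_distrib_right)
    also have "\<dots> = (\<Sum>j\<in>?A. if i = j then Y j else 0)"
      using R i by (intro sum.cong) (auto simp: orthogonal_on_def)
    also have "\<dots> = Y i" using i finite_multi_indices by simp
    finally show ?thesis by simp
  qed
  then have "\<forall>Y :: tensor. \<exists>c. \<forall>i\<in>?A. Y i = (\<Sum>l\<in>?B. U i l * c l)"
    by (intro allI exI ballI)
  with R show ?L by (simp add: orthonormal_basis_def orthogonal_on_def)
qed

text \<open>The permutation matrix of a bijection is a witness. This makes the feasible set of the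
  minimisation nonempty.\<close>

lemma ex_orthogonal_on:
  assumes "finite A" "finite B" "card A = card B"
  shows "\<exists>V. orthogonal_on A B V"
proof -
  obtain f where f: "bij_betw f A B" using assms finite_same_card_bij by blast
  define V :: "'a \<Rightarrow> 'b \<Rightarrow> real" where "V i l = (if f i = l then 1 else 0)" for i l
  have "(\<Sum>i\<in>A. V i l * V i m) = (if l = m then 1 else 0)" if "l \<in> B" "m \<in> B" for l m
  proof -
    have "(\<Sum>i\<in>A. V i l * V i m)
        = (\<Sum>k\<in>B. (if k = l then 1 else 0) * (if k = m then 1 else 0))"
      unfolding V_def by (rule sum.reindex_bij_betw[OF f])
    also have "\<dots> = (\<Sum>k\<in>B. if k = l then (if l = m then 1 else 0) else 0)"
      by (intro sum.cong) auto
    finally show ?thesis using that assms by simp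
  qed
  moreover have "(\<Sum>l\<in>B. V i l * V j l) = (if i = j then 1 else 0)" if "i \<in> A" "j \<in> A" for i j
  proof -
    have "(\<Sum>l\<in>B. V i l * V j l) = (\<Sum>l\<in>B. if f i = l then (if i = j then 1 else 0) else 0)"
      using bij_betw_imp_inj_on[OF f] that
      by (intro sum.cong) (auto simp: V_def dest: inj_onD)
    then show ?thesis using that assms bij_betwE[OF f] by simp
  qed
  ultimately show ?thesis unfolding orthogonal_on_def by blast
qed

section \<open>The error as a Rayleigh sum of the covariance\<close>

lemma tensor_norm_sq: "(tensor_norm d I Y)\<^sup>2 = (\<Sum>i\<in>multi_indices d I. (Y i)\<^sup>2)"
  by (simp add: tensor_norm_def tensor_inner_def sum_nonneg power2_eq_square)

text \<open>Pythagoras: by orthonormality, the cross term and the squared norm of the representation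
  both equal the sum of squared coefficients.\<close>

lemma tensor_norm_sq_error:
  assumes U: "orthonormal_basis d I U" and M: "M \<le> tensor_dim d I"
  shows "(tensor_norm d I (\<lambda>i. Y i - subspace_repr d I M U Y i))\<^sup>2 =
    (tensor_norm d I Y)\<^sup>2 - (\<Sum>l=1..M. (basis_coeff d I U Y l)\<^sup>2)"
proof -
  let ?A = "multi_indices d I" and ?a = "basis_coeff d I U Y" and ?S = "subspace_repr d I M U Y"
  have cross: "(\<Sum>i\<in>?A. Y i * ?S i) = (\<Sum>l=1..M. (?a l)\<^sup>2)"
  proof -
    have "(\<Sum>i\<in>?A. Y i * ?S i) = (\<Sum>i\<in>?A. \<Sum>l=1..M. ?a l * (Y i * U i l))"
      by (simp add: subspace_repr_def sum_distrib_left mult_ac)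
    also have "\<dots> = (\<Sum>l=1..M. \<Sum>i\<in>?A. ?a l * (Y i * U i l))" by (rule sum.swap)
    also have "\<dots> = (\<Sum>l=1..M. (?a l)\<^sup>2)"
      by (simp add: basis_coeff_def power2_eq_square flip: sum_distrib_left)
    finally show ?thesis .
  qed
  have square: "(\<Sum>i\<in>?A. ?S i * ?S i) = (\<Sum>l=1..M. (?a l)\<^sup>2)"
  proof -
    have "(\<Sum>i\<in>?A. ?S i * ?S i)
        = (\<Sum>i\<in>?A. \<Sum>l=1..M. \<Sum>m=1..M. ?a l * ?a m * (U i l * U i m))"
      by (simp add: subspace_repr_def sum_product mult_ac)
    also have "\<dots> = (\<Sum>l=1..M. \<Sum>i\<in>?A. \<Sum>m=1..M. ?a l * ?a m * (U i l * U i m))"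
      by (rule sum.swap)
    also have "\<dots> = (\<Sum>l=1..M. \<Sum>m=1..M. \<Sum>i\<in>?A. ?a l * ?a m * (U i l * U i m))"
      by (intro sum.cong refl sum.swap)
    also have "\<dots> = (\<Sum>l=1..M. \<Sum>m=1..M. ?a l * ?a m * (\<Sum>i\<in>?A. U i l * U i m))"
      by (simp only: sum_distrib_left)
    also have "\<dots> = (\<Sum>l=1..M. \<Sum>m=1..M. if l = m then (?a l)\<^sup>2 else 0)"
      using U M by (intro sum.cong refl) (auto simp: orthonormal_basis_def power2_eq_square)
    finally show ?thesis by simp
  qed
  have "(\<Sum>i\<in>?A. (Y i - ?S i)\<^sup>2)
      = (\<Sum>i\<in>?A. (Y i)\<^sup>2) - 2 * (\<Sum>i\<in>?A. Y i * ?S i) + (\<Sum>i\<in>?A. ?S i * ?S i)"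
    by (simp add: sum_distrib_left power2_eq_square algebra_simps flip: sum.distrib sum_subtractf)
  then show ?thesis unfolding tensor_norm_sq cross square by simp
qed

text \<open>The squared norm dominates the product by the inequality of arithmetic and geometric
  means. Hence covariance entries are genuine expectations, not the default 0 of a nonintegrable
  function.\<close>

lemma integrable_tensor_entries_mult:
  assumes meas: "\<And>i. i \<in> multi_indices d I \<Longrightarrow> (\<lambda>\<omega>. X \<omega> i) \<in> borel_measurable P"
    and int: "integrable P (\<lambda>\<omega>. (tensor_norm d I (X \<omega>))\<^sup>2)"
    and ij: "i \<in> multi_indices d I" "j \<in> multi_indices d I"
  shows "integrable P (\<lambda>\<omega>. X \<omega> i * X \<omega> j)"
proof (rule Bochner_Integration.integrable_bound[OF int])
  show "(\<lambda>\<omega>. X \<omega> i * X \<omega> j) \<in> borel_measurable P"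
    using meas ij by (intro borel_measurable_times)
  have "\<bar>X \<omega> i * X \<omega> j\<bar> \<le> (tensor_norm d I (X \<omega>))\<^sup>2" for \<omega>
  proof -
    have amgm: "\<bar>x * y\<bar> \<le> (x\<^sup>2 + y\<^sup>2) / 2" for x y :: real
      using sum_squares_bound[of "\<bar>x\<bar>" "\<bar>y\<bar>"] by (simp add: abs_mult)
    have "(X \<omega> k)\<^sup>2 \<le> (tensor_norm d I (X \<omega>))\<^sup>2" if "k \<in> multi_indices d I" for k
      unfolding tensor_norm_sq using that finite_multi_indices
      by (intro member_le_sum[where f = "\<lambda>k. (X \<omega> k)\<^sup>2"]) auto
    from this[OF ij(1)] this[OF ij(2)] have "((X \<omega> i)\<^sup>2 + (X \<omega> j)\<^sup>2) / 2 \<le> (tensor_norm d I (X \<omega>))\<^sup>2"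
      by simp
    with amgm show ?thesis by (rule order_trans)
  qed
  then show "AE \<omega> in P. norm (X \<omega> i * X \<omega> j) \<le> norm ((tensor_norm d I (X \<omega>))\<^sup>2)"
    by simp
qed

text \<open>The expected square of a coefficient is the quadratic form of the covariance at that
  basis tensor. The first term is independent of \<open>U\<close>, so minimising the error means
  maximising the Rayleigh sum.\<close>

lemma approx_error_eq:
  assumes meas: "\<And>i. i \<in> multi_indices d I \<Longrightarrow> (\<lambda>\<omega>. X \<omega> i) \<in> borel_measurable P"
    and int: "integrable P (\<lambda>\<omega>. (tensor_norm d I (X \<omega>))\<^sup>2)"
    and U: "orthonormal_basis d I U" and M: "M \<le> tensor_dim d I"
  shows "approx_error P X d I M U = (\<integral>\<omega>. (tensor_norm d I (X \<omega>))\<^sup>2 \<partial>P) -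
    rayleigh_sum (multi_indices d I) {1..tensor_dim d I} (covariance P X) (\<lambda>l. of_bool (l \<le> M)) U"
proof -
  let ?A = "multi_indices d I"
  note int_mult = integrable_tensor_entries_mult[OF meas int]
  have sq: "(basis_coeff d I U (X \<omega>) l)\<^sup>2 = (\<Sum>i\<in>?A. \<Sum>j\<in>?A. X \<omega> i * X \<omega> j * (U i l * U j l))"
    for \<omega> l
    by (simp add: basis_coeff_def power2_eq_square sum_product mult_ac)
  have int_sq: "integrable P (\<lambda>\<omega>. (basis_coeff d I U (X \<omega>) l)\<^sup>2)" for l
    unfolding sq by (intro Bochner_Integration.integrable_sum integrable_mult_left int_mult)
  have E_sq: "(\<integral>\<omega>. (basis_coeff d I U (X \<omega>) l)\<^sup>2 \<partial>P)
      = bilin ?A (covariance P X) (\<lambda>i. U i l) (\<lambda>i. U i l)" for l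
  proof -
    have "(\<integral>\<omega>. (basis_coeff d I U (X \<omega>) l)\<^sup>2 \<partial>P)
        = (\<Sum>i\<in>?A. \<Sum>j\<in>?A. \<integral>\<omega>. X \<omega> i * X \<omega> j * (U i l * U j l) \<partial>P)"
      unfolding sq
      by (subst Bochner_Integration.integral_sum;
          (intro Bochner_Integration.integrable_sum integrable_mult_left int_mult sum.cong refl
            Bochner_Integration.integral_sum)?)
    then show ?thesis by (simp add: bilin_def covariance_def flip: mult.assoc)
  qed
  have "approx_error P X d I M U
      = (\<integral>\<omega>. (tensor_norm d I (X \<omega>))\<^sup>2 - (\<Sum>l=1..M. (basis_coeff d I U (X \<omega>) l)\<^sup>2) \<partial>P)"
    unfolding approx_error_def tensor_norm_sq_error[OF U M] ..
  also have "\<dots> = (\<integral>\<omega>. (tensor_norm d I (X \<omega>))\<^sup>2 \<partial>P)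
      - (\<Sum>l=1..M. bilin ?A (covariance P X) (\<lambda>i. U i l) (\<lambda>i. U i l))"
    using int int_sq
    by (simp add: Bochner_Integration.integral_diff Bochner_Integration.integral_sum E_sq)
  also have "(\<Sum>l=1..M. bilin ?A (covariance P X) (\<lambda>i. U i l) (\<lambda>i. U i l))
      = rayleigh_sum ?A {1..tensor_dim d I} (covariance P X) (\<lambda>l. of_bool (l \<le> M)) U"
    unfolding rayleigh_sum_def using M by (intro sum.mono_neutral_cong_left) auto
  finally show ?thesis .
qed

section \<open>Replacing a minimiser by eigentensors\<close>

text \<open>The representation contracts \<open>Y\<close> with the kernel of the projection, so it
  depends on the basis only through that kernel.\<close>

lemma subspace_repr_cong:
  assumes proj: "\<And>j. j \<in> multi_indices d I \<Longrightarrow> (\<Sum>l=1..M. V i l * V j l) = (\<Sum>l=1..M. U i l * U j l)"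
  shows "subspace_repr d I M V Y i = subspace_repr d I M U Y i"
proof -
  let ?A = "multi_indices d I"
  have "subspace_repr d I M W Y i = (\<Sum>j\<in>?A. Y j * (\<Sum>l=1..M. W i l * W j l))" for W
  proof -
    have "subspace_repr d I M W Y i = (\<Sum>l=1..M. \<Sum>j\<in>?A. Y j * (W i l * W j l))"
      by (simp add: subspace_repr_def basis_coeff_def sum_distrib_left mult_ac)
    also have "\<dots> = (\<Sum>j\<in>?A. \<Sum>l=1..M. Y j * (W i l * W j l))" by (rule sum.swap)
    finally show ?thesis by (simp add: sum_distrib_left)
  qed
  with proj show ?thesis by simp
qed

text \<open>Rotations among the first \<open>M\<close> tensors, or among the others, leave the error
  unchanged, so an arbitrary minimiser need not consist of eigentensors. Hence each minimiser is
  matched with a minimising eigenbasis that has the same subspace representation.\<close>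

theorem proposition2:
  fixes P :: "'a measure" and X :: "'a \<Rightarrow> tensor"
    and d :: nat and I :: "nat \<Rightarrow> nat" and M :: nat
  assumes "prob_space P"
    and "M < tensor_dim d I"
    and "\<And>i. i \<in> multi_indices d I \<Longrightarrow> (\<lambda>\<omega>. X \<omega> i) \<in> borel_measurable P"
    and "integrable P (\<lambda>\<omega>. (tensor_norm d I (X \<omega>))\<^sup>2)"
  shows "(\<exists>U. is_arg_min (approx_error P X d I M) (orthonormal_basis d I) U) \<and>
    (\<forall>U. is_arg_min (approx_error P X d I M) (orthonormal_basis d I) U \<longrightarrow>
      (\<exists>V. is_arg_min (approx_error P X d I M) (orthonormal_basis d I) V \<and>
        (\<forall>Y. \<forall>i\<in>multi_indices d I. subspace_repr d I M V Y i = subspace_repr d I M U Y i) \<and>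
        solves_eigenvalue_eq d I (covariance P X) V))"
proof (intro conjI allI impI)
  let ?A = "multi_indices d I" and ?B = "{1..tensor_dim d I}" and ?R = "covariance P X"
  let ?w = "\<lambda>l. of_bool (l \<le> M) :: real" and ?E = "approx_error P X d I M"
  note fin = finite_multi_indices[of d I] finite_atLeastAtMost[of 1 "tensor_dim d I"]
  have M: "M \<le> tensor_dim d I" using assms(2) by simp
  have R: "?R i j = ?R j i" for i j by (simp add: covariance_def mult.commute)
  have argmin: "is_arg_min ?E (orthonormal_basis d I) U \<longleftrightarrow> orthogonal_on ?A ?B U \<and>
      (\<forall>W. orthogonal_on ?A ?B W \<longrightarrow> rayleigh_sum ?A ?B ?R ?w W \<le> rayleigh_sum ?A ?B ?R ?w U)" for U
    unfolding is_arg_min_def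
    by (metis (no_types, lifting) approx_error_eq[OF assms(3,4) _ M] orthonormal_basis_iff
        diff_strict_left_mono diff_left_mono not_le)
  show "\<exists>U. is_arg_min ?E (orthonormal_basis d I) U"
  proof -
    obtain U where "orthogonal_on ?A ?B U"
      using ex_orthogonal_on[OF fin] by (auto simp: card_multi_indices)
    \<comment> \<open>With \<open>C\<close> empty and \<open>T\<close> zero the projection
      constraint is vacuous, so the maximum is over all orthonormal bases.\<close>
    then show ?thesis
      using rayleigh_sum_attains_max[OF fin, of "{}" U "\<lambda>_ _. 0" ?R ?w] by (auto simp: argmin)
  qed
  fix U assume U: "is_arg_min ?E (orthonormal_basis d I) U"
  define S where "S = {V. orthogonal_on ?A ?B V \<and>
    (\<forall>i\<in>?A. \<forall>j\<in>?A. (\<Sum>l=1..M. V i l * V j l) = (\<Sum>l=1..M. U i l * U j l))}"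
  have "U \<in> S" using U by (simp add: S_def argmin)
  \<comment> \<open>The weights \<open>real\<close> are pairwise distinct, so maximality yields a
    condition for every pair of indices on the same side of \<open>M\<close>.\<close>
  then obtain V where V: "V \<in> S"
    and max: "\<And>W. W \<in> S \<Longrightarrow> rayleigh_sum ?A ?B ?R real W \<le> rayleigh_sum ?A ?B ?R real V"
    using rayleigh_sum_attains_max[OF fin, of "{1..M}" U "\<lambda>i j. \<Sum>l=1..M. U i l * U j l" ?R real] M
    unfolding S_def by auto
  have orth: "orthogonal_on ?A ?B V" using V by (simp add: S_def)
  have repr: "subspace_repr d I M V Y i = subspace_repr d I M U Y i" if "i \<in> ?A" for Y i
    using V that by (intro subspace_repr_cong) (simp add: S_def)
  then have "?E V = ?E U"
    by (simp add: approx_error_def tensor_norm_sq)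
  then have V_min: "is_arg_min ?E (orthonormal_basis d I) V"
    using U orth by (simp add: is_arg_min_def orthonormal_basis_iff)
  have diag: "bilin ?A ?R (\<lambda>i. V i q) (\<lambda>i. V i p) = 0" if pq: "q \<in> ?B" "p \<in> ?B" "q \<noteq> p" for p q
  proof (cases "q \<le> M \<longleftrightarrow> p \<le> M")
    case True
    show ?thesis
    proof (rule bilin_zero_if_rotation_maximal[OF R fin(2) pq, where w = real])
      fix c s :: real assume cs: "c\<^sup>2 + s\<^sup>2 = 1"
      have "rotate_cols q p c s V \<in> S"
        using V orthogonal_on_rotate_cols[OF orth fin(2) pq cs] True pq
        by (simp add: S_def sum_rotate_cols[OF _ _ _ cs])
      then show "rayleigh_sum ?A ?B ?R real (rotate_cols q p c s V) \<le> rayleigh_sum ?A ?B ?R real V"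
        by (rule max)
    qed (use pq in simp)
  next
    case False
    \<comment> \<open>The rotated basis may leave \<open>S\<close>, but here the indicator weights
      differ at \<open>p\<close> and \<open>q\<close>, and minimality of the error compares
      \<open>V\<close> with all orthonormal bases.\<close>
    show ?thesis
    proof (rule bilin_zero_if_rotation_maximal[OF R fin(2) pq, where w = ?w])
      fix c s :: real assume "c\<^sup>2 + s\<^sup>2 = 1"
      then show "rayleigh_sum ?A ?B ?R ?w (rotate_cols q p c s V) \<le> rayleigh_sum ?A ?B ?R ?w V"
        using V_min orthogonal_on_rotate_cols[OF orth fin(2) pq] by (simp add: argmin)
    qed (use False in auto)
  qed
  have "solves_eigenvalue_eq d I ?R V"
    unfolding solves_eigenvalue_eq_def
    using eigenvector_if_diagonal[OF orth fin _ _ diag]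
    by (intro exI[of _ "\<lambda>p. bilin ?A ?R (\<lambda>i. V i p) (\<lambda>i. V i p)"]) blast
  with V_min repr show "\<exists>V. is_arg_min ?E (orthonormal_basis d I) V \<and>
      (\<forall>Y. \<forall>i\<in>?A. subspace_repr d I M V Y i = subspace_repr d I M U Y i) \<and>
      solves_eigenvalue_eq d I ?R V"
    by blast
qed

end
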